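(* For every integer $n\ge 0$, $$\sum_{T\in \mathcal{PT}(n)} 2^{\operatorname{urc}(T)} = f(n+1),$$ where $f(m)$ denotes the number of connected permutations of $\{1,2,\dots,m\}$.
   Context: Connected permutations: a permutation $\pi=\pi_1\cdots\pi_m$ of $\{1,\dots,m\}$ is connected if there is no integer $1\le k<m$ such that $\pi_1\cdots\pi_k$ is a permutation of $\{1,\dots,k\}$. Ferrers diagrams: a Ferrers diagram is a left-justified arrangement of square cells, possibly with empty rows; its length is the number of rows plus the number of columns. The steps of the south-east border are labeled $1,\dots,n$ from north-east to south-west ($n$ the length); a row gets the label of its south step and a column the label of its west step. Equivalently, a diagram of length $n$ is a splitting of $\{1,\dots,n\}$ into row labels and column labels; rows are listed top to bottom in increasing order of label, columns left to right in decreasing order of label, and there is a cell in Row $r$ and Column $c$ exactly when $r<c$. Permutation tableaux: a permutation tableau is a Ferrers diagram with a filling of its cells by $0$'s and $1$'s such that (1) each column has at least one $1$; (2) there is no $0$ having both a $1$ above it in the same column and a $1$ to the left of it in the same row. $\mathcal{PT}(n)$ is the set of permutation tableaux of length $n$ ($\mathcal{PT}(0)$ consists of the single empty tableau). A column is unrestricted if it contains no $0$ that has a $1$ to the left of it in the same row; $\operatorname{urc}(T)$ is the number of unrestricted columns of $T$. *)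

theory Defs
  imports "HOL-Combinatorics.Permutations" "HOL-Library.FuncSet"
begin

definition connected_perm :: "nat \<Rightarrow> (nat \<Rightarrow> nat) \<Rightarrow> bool" where
  "connected_perm m p \<longleftrightarrow>
     p permutes {1..m} \<and> \<not> (\<exists>k. 1 \<le> k \<and> k < m \<and> p ` {1..k} = {1..k})"

definition num_connected_perms :: "nat \<Rightarrow> nat" where
  "num_connected_perms m = card {p. connected_perm m p}"

text \<open>
  A Ferrers diagram of length \<open>n\<close> (empty rows and columns allowed) is represented by the set
  \<open>R\<close> of its row labels, a subset of \<open>{1..n}\<close>; the column labels are the remaining elements.
  Rows are read top to bottom by increasing label, columns left to right by decreasing label.
  So Row \<open>r'\<close> is above Row \<open>r\<close> iff \<open>r' < r\<close>, and Column \<open>c'\<close> is to the left of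
  Column \<open>c\<close> iff \<open>c < c'\<close>.
\<close>

definition col_labels :: "nat \<Rightarrow> nat set \<Rightarrow> nat set" where
  "col_labels n R = {1..n} - R"

definition cells :: "nat \<Rightarrow> nat set \<Rightarrow> (nat \<times> nat) set" where
  "cells n R = {(r, c). r \<in> R \<and> c \<in> col_labels n R \<and> r < c}"

definition one_above :: "nat \<Rightarrow> nat set \<Rightarrow> (nat \<times> nat \<Rightarrow> nat) \<Rightarrow> nat \<Rightarrow> nat \<Rightarrow> bool" where
  "one_above n R F r c \<longleftrightarrow> (\<exists>r'. r' < r \<and> (r', c) \<in> cells n R \<and> F (r', c) = 1)"

definition one_left :: "nat \<Rightarrow> nat set \<Rightarrow> (nat \<times> nat \<Rightarrow> nat) \<Rightarrow> nat \<Rightarrow> nat \<Rightarrow> bool" where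
  "one_left n R F r c \<longleftrightarrow> (\<exists>c'. c < c' \<and> (r, c') \<in> cells n R \<and> F (r, c') = 1)"

text \<open>
  A tableau is a pair of the diagram and its filling.  Fillings are extensional functions
  (undefined outside the cells), so that distinct pairs are distinct tableaux.
\<close>

definition permutation_tableaux :: "nat \<Rightarrow> (nat set \<times> (nat \<times> nat \<Rightarrow> nat)) set" where
  "permutation_tableaux n = {(R, F).
     R \<subseteq> {1..n} \<and> F \<in> cells n R \<rightarrow>\<^sub>E {0, 1} \<and>
     (\<forall>c\<in>col_labels n R. \<exists>r. (r, c) \<in> cells n R \<and> F (r, c) = 1) \<and>
     \<not> (\<exists>(r, c)\<in>cells n R. F (r, c) = 0 \<and> one_above n R F r c \<and> one_left n R F r c)}"

definition unrestricted_col :: "nat \<Rightarrow> nat set \<Rightarrow> (nat \<times> nat \<Rightarrow> nat) \<Rightarrow> nat \<Rightarrow> bool" where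
  "unrestricted_col n R F c \<longleftrightarrow>
     c \<in> col_labels n R \<and>
     \<not> (\<exists>r. (r, c) \<in> cells n R \<and> F (r, c) = 0 \<and> one_left n R F r c)"

definition urc :: "nat \<Rightarrow> nat set \<times> (nat \<times> nat \<Rightarrow> nat) \<Rightarrow> nat" where
  "urc n T = card {c. unrestricted_col n (fst T) (snd T) c}"

text \<open>Finiteness, so that the sum over all tableaux of length \<open>n\<close> is a genuine sum.\<close>

lemma finite_permutation_tableaux: "finite (permutation_tableaux n)"
proof -
  have "finite (cells n R)" if "R \<subseteq> {1..n}" for R
    by (rule finite_subset[of _ "{1..n} \<times> {1..n}"]) (use that in \<open>auto simp: cells_def col_labels_def\<close>)
  then have "finite (Sigma (Pow {1..n}) (\<lambda>R. cells n R \<rightarrow>\<^sub>E {0, 1 :: nat}))"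
    by (intro finite_SigmaI finite_PiE) auto
  then show ?thesis
    by (rule finite_subset[rotated]) (auto simp: permutation_tableaux_def)
qed

end

theory Submission
  imports Defs
begin

text \<open>
  The sum counts tableaux with a set of marked unrestricted columns.  These are built by
  appending the labels \<open>1, 2, \<dots>, n\<close>.  Call a row active if it can still receive a
  \<open>1\<close> in a new leftmost column, i.e. if no \<open>0\<close> of it lies below a \<open>1\<close> or
  in a marked column.  A new row is active; a new column puts \<open>1\<close>s in a nonempty set
  \<open>S\<close> of active rows, after which the rows of \<open>S\<close> and, if the column is unmarked, the
  active rows above \<open>S\<close> stay active.  If \<open>p\<^sub>n(x)\<close> weights each marked tableau by
  \<open>x\<close> to the number of active rows, this gives \<open>p\<^sub>n\<^sub>+\<^sub>1(x) = (1 + x) p\<^sub>n(1 + x) - p\<^sub>n(1)\<close>.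
  Unfolding the recurrence, and using \<open>p\<^sub>n\<^sub>+\<^sub>1(0) = 0\<close>, yields
  \<open>(n + 1)! = \<Sum>j\<le>n. p\<^sub>j(1) (n - j)!\<close>, which is also the recurrence for connected
  permutations obtained by splitting a permutation after its first connected component.
\<close>

section \<open>Sums of powers over the subsets of a finite set\<close>

lemma sum_Pow_insert:
  fixes g :: "'a set \<Rightarrow> 'b::comm_monoid_add"
  assumes "finite A" "a \<notin> A"
  shows "(\<Sum>S\<in>Pow (insert a A). g S) = (\<Sum>S\<in>Pow A. g S) + (\<Sum>S\<in>Pow A. g (insert a S))"
proof -
  have "inj_on (insert a) (Pow A)"
    using assms(2) by (auto simp: inj_on_def)
  then have "(\<Sum>S\<in>insert a ` Pow A. g S) = (\<Sum>S\<in>Pow A. g (insert a S))"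
    by (simp add: sum.reindex)
  moreover have "(\<Sum>S\<in>Pow A \<union> insert a ` Pow A. g S) = (\<Sum>S\<in>Pow A. g S) + (\<Sum>S\<in>insert a ` Pow A. g S)"
    using assms by (intro sum.union_disjoint) auto
  ultimately show ?thesis
    by (simp add: Pow_insert)
qed

lemma sum_Pow_power_card:
  fixes x :: "'b::comm_semiring_1"
  assumes "finite A"
  shows "(\<Sum>S\<in>Pow A. x ^ card S) = (1 + x) ^ card A"
  using assms
proof (induction A)
  case (insert a A)
  have "(\<Sum>S\<in>Pow A. x ^ card (insert a S)) = (\<Sum>S\<in>Pow A. x * x ^ card S)"
    using insert.hyps by (intro sum.cong refl) (auto simp: card_insert_if finite_subset)
  then show ?case
    using insert by (simp add: sum_Pow_insert flip: sum_distrib_left) (simp add: algebra_simps)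
qed simp

text \<open>Induction on a new maximum \<open>m\<close>. If a nonempty \<open>S\<close> omits
  \<open>m\<close>, then \<open>m\<close> lies above \<open>S\<close> and is not counted; if
  \<open>S\<close> contains \<open>m\<close>, then \<open>m\<close> is counted and, being an upper
  bound, imposes nothing on the others: a factor \<open>x\<close>. With the extra summand
  \<open>x * x ^ card A\<close> the left side is multiplied by exactly \<open>1 + x\<close> at each
  step. In the application this summand is the weight of a new row and the sum is that of the
  unmarked new columns.\<close>

lemma sum_Pow_power_card_initial:
  fixes A :: "'a::linorder set" and x :: "'b::comm_semiring_1_cancel"
  assumes "finite A"
  shows "(\<Sum>S\<in>Pow A - {{}}. x ^ card {r\<in>A. r \<in> S \<or> (\<forall>s\<in>S. r \<le> s)}) + x * x ^ card A
    = x * (1 + x) ^ card A"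
  using assms
proof (induction A rule: finite_linorder_max_induct)
  case (insert m B)
  let ?w = "\<lambda>A S. x ^ card {r\<in>A. r \<in> S \<or> (\<forall>s\<in>S. r \<le> s)}"
  have m: "m \<notin> B" using insert.hyps by auto
  have split: "(\<Sum>S\<in>Pow B. g S) = g {} + (\<Sum>S\<in>Pow B - {{}}. g S)" for g :: "'a set \<Rightarrow> 'b"
    using insert.hyps by (intro sum.remove) auto
  have split': "(\<Sum>S\<in>Pow (insert m B). g S) = g {} + (\<Sum>S\<in>Pow (insert m B) - {{}}. g S)"
    for g :: "'a set \<Rightarrow> 'b"
    using insert.hyps by (intro sum.remove) auto
  have 1: "?w (insert m B) S = ?w B S" if "S \<in> Pow B - {{}}" for S
  proof -
    have "{r\<in>insert m B. r \<in> S \<or> (\<forall>s\<in>S. r \<le> s)} = {r\<in>B. r \<in> S \<or> (\<forall>s\<in>S. r \<le> s)}"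
      using that insert.hyps m by fastforce
    then show ?thesis by simp
  qed
  have 2: "?w (insert m B) (insert m S) = x * ?w B S" if "S \<in> Pow B" for S
  proof -
    have "{r\<in>insert m B. r \<in> insert m S \<or> (\<forall>s\<in>insert m S. r \<le> s)}
        = insert m {r\<in>B. r \<in> S \<or> (\<forall>s\<in>S. r \<le> s)}"
      using that insert.hyps m by force
    then show ?thesis using insert.hyps m by simp
  qed
  \<comment> \<open>For empty \<open>S\<close> the bound by all \<open>s\<close> in \<open>S\<close>
    is vacuous, so every element counts.\<close>
  have 3: "?w B {} = x ^ card B" "?w (insert m B) {} = x * x ^ card B"
    using insert.hyps m by (simp_all flip: insert_def add: insert_compr[symmetric])
  have "(\<Sum>S\<in>Pow (insert m B). ?w (insert m B) S)
      = (\<Sum>S\<in>Pow B. ?w (insert m B) S) + (\<Sum>S\<in>Pow B. ?w (insert m B) (insert m S))"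
    using insert.hyps m by (intro sum_Pow_insert) auto
  also have "(\<Sum>S\<in>Pow B. ?w (insert m B) (insert m S)) = x * (\<Sum>S\<in>Pow B. ?w B S)"
    unfolding sum_distrib_left by (intro sum.cong refl 2)
  also have "(\<Sum>S\<in>Pow B - {{}}. ?w (insert m B) S) = (\<Sum>S\<in>Pow B - {{}}. ?w B S)"
    by (intro sum.cong refl 1)
  then have "(\<Sum>S\<in>Pow B. ?w (insert m B) S) = x * x ^ card B + (\<Sum>S\<in>Pow B - {{}}. ?w B S)"
    unfolding split 3 by simp
  also have "(\<Sum>S\<in>Pow B. ?w B S) = x ^ card B + (\<Sum>S\<in>Pow B - {{}}. ?w B S)"
    unfolding split 3 ..
  finally have "x * x ^ card B + (\<Sum>S\<in>Pow (insert m B) - {{}}. ?w (insert m B) S)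
     = x * x ^ card B + (\<Sum>S\<in>Pow B - {{}}. ?w B S) + x * (x ^ card B + (\<Sum>S\<in>Pow B - {{}}. ?w B S))"
    unfolding split' 3 .
  then have "(\<Sum>S\<in>Pow (insert m B) - {{}}. ?w (insert m B) S)
      = (1 + x) * (\<Sum>S\<in>Pow B - {{}}. ?w B S) + x * x ^ card B"
    by (simp add: algebra_simps)
  then have "(\<Sum>S\<in>Pow (insert m B) - {{}}. ?w (insert m B) S) + x * x ^ card (insert m B)
      = (1 + x) * ((\<Sum>S\<in>Pow B - {{}}. ?w B S) + x * x ^ card B)"
    using insert.hyps m by (simp add: algebra_simps)
  also have "\<dots> = x * (1 + x) ^ card (insert m B)"
    unfolding insert.IH using insert.hyps m by (simp add: algebra_simps)
  finally show ?case .
qed simp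

section \<open>Marked tableaux and the effect of appending one label\<close>

text \<open>
  A triple \<open>(R, Z, M)\<close> consists of the row labels, the cells filled with \<open>1\<close> and the
  marked columns.  The last condition combines the tableau condition on \<open>0\<close>s with the
  unrestrictedness of the marked columns.
\<close>

type_synonym marked_tableau = "nat set \<times> (nat \<times> nat) set \<times> nat set"

definition marked_tableaux :: "nat \<Rightarrow> marked_tableau set" where
  "marked_tableaux n = {(R, Z, M).
     R \<subseteq> {1..n} \<and> Z \<subseteq> cells n R \<and> M \<subseteq> col_labels n R \<and>
     (\<forall>c\<in>col_labels n R. \<exists>r. (r, c) \<in> Z) \<and>
     (\<forall>(r, c)\<in>cells n R - Z. (c \<in> M \<or> (\<exists>r'<r. (r', c) \<in> Z)) \<longrightarrow> \<not> (\<exists>c'>c. (r, c') \<in> Z))}"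

fun active_rows :: "nat \<Rightarrow> marked_tableau \<Rightarrow> nat set" where
  "active_rows n (R, Z, M) =
     {r\<in>R. \<forall>c. (r, c) \<in> cells n R - Z \<longrightarrow> c \<notin> M \<and> \<not> (\<exists>r'<r. (r', c) \<in> Z)}"

fun add_row :: "nat \<Rightarrow> marked_tableau \<Rightarrow> marked_tableau" where
  "add_row n (R, Z, M) = (insert (Suc n) R, Z, M)"

text \<open>The argument \<open>B\<close> is \<open>{Suc n}\<close> if the new column is marked and \<open>{}\<close> otherwise.\<close>

fun add_col :: "nat \<Rightarrow> nat set \<Rightarrow> nat set \<Rightarrow> marked_tableau \<Rightarrow> marked_tableau" where
  "add_col n B S (R, Z, M) = (R, Z \<union> S \<times> {Suc n}, M \<union> B)"

lemma cells_Suc_row: "R \<subseteq> {1..n} \<Longrightarrow> cells (Suc n) (insert (Suc n) R) = cells n R"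
  by (auto simp: cells_def col_labels_def)

lemma cells_Suc_col: "R \<subseteq> {1..n} \<Longrightarrow> cells (Suc n) R = cells n R \<union> R \<times> {Suc n}"
  by (auto simp: cells_def col_labels_def)

lemma col_labels_Suc_row: "R \<subseteq> {1..n} \<Longrightarrow> col_labels (Suc n) (insert (Suc n) R) = col_labels n R"
  by (auto simp: col_labels_def)

lemma col_labels_Suc_col: "R \<subseteq> {1..n} \<Longrightarrow> col_labels (Suc n) R = insert (Suc n) (col_labels n R)"
  by (auto simp: col_labels_def)

lemma finite_marked_tableaux: "finite (marked_tableaux n)"
proof (rule finite_subset)
  show "marked_tableaux n \<subseteq> Pow {1..n} \<times> Pow ({1..n} \<times> {1..n}) \<times> Pow {1..n}"
    by (fastforce simp: marked_tableaux_def cells_def col_labels_def)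
qed simp

lemma finite_active_rows: "T \<in> marked_tableaux n \<Longrightarrow> finite (active_rows n T)"
  by (cases T) (auto simp: marked_tableaux_def intro: finite_subset)

text \<open>The label \<open>Suc n\<close> exceeds every column label, so the new row has no cells
  and no condition changes.\<close>

lemma add_row_marked_iff:
  "R \<subseteq> {1..n} \<Longrightarrow> (insert (Suc n) R, Z, M) \<in> marked_tableaux (Suc n) \<longleftrightarrow> (R, Z, M) \<in> marked_tableaux n"
  by (auto simp: marked_tableaux_def cells_Suc_row col_labels_Suc_row)

text \<open>A row without cells is active vacuously; the old rows keep their cells and so their
  status.\<close>

lemma active_rows_add_row:
  assumes "T \<in> marked_tableaux n"
  shows "active_rows (Suc n) (add_row n T) = insert (Suc n) (active_rows n T)"
proof (cases T)
  case (fields R Z M)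
  then have "R \<subseteq> {1..n}" using assms by (simp add: marked_tableaux_def)
  moreover have "(Suc n, c) \<notin> cells n R" for c
    by (auto simp: cells_def col_labels_def)
  ultimately show ?thesis
    unfolding fields by (auto simp: cells_Suc_row)
qed

text \<open>The new column is leftmost, so it puts a \<open>1\<close> to the left of every old cell
  in the rows of \<open>S\<close>; the \<open>0\<close>s there tolerate this exactly if these rows
  are active. The column needs a \<open>1\<close>, so \<open>S\<close> is nonempty. Nothing is to
  the left of the new cells, so marking the column is free and \<open>B\<close> does not enter the
  condition.\<close>

lemma add_col_marked_iff:
  assumes R: "R \<subseteq> {1..n}" and Z: "Z \<subseteq> cells n R" and M: "M \<subseteq> col_labels n R"
    and "B \<subseteq> {Suc n}"
  shows "add_col n B S (R, Z, M) \<in> marked_tableaux (Suc n) \<longleftrightarrow>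
    (R, Z, M) \<in> marked_tableaux n \<and> S \<in> Pow (active_rows n (R, Z, M)) - {{}}"
proof -
  have cell: "c \<le> n \<and> r \<in> R" if "(r, c) \<in> cells n R" for r c
    using that by (auto simp: cells_def col_labels_def)
  have Zn: "c \<le> n" if "(r, c) \<in> Z" for r c
    using Z that cell by blast
  have Mn: "Suc n \<notin> M" "Suc n \<notin> col_labels n R"
    using M by (auto simp: col_labels_def)
  let ?Z = "Z \<union> S \<times> {Suc n}" and ?M = "M \<union> B"
  have above: "(c \<in> ?M \<or> (\<exists>r'<r. (r', c) \<in> ?Z)) \<longleftrightarrow> (c \<in> M \<or> (\<exists>r'<r. (r', c) \<in> Z))"
    if "c \<le> n" for r c
    using that assms(4) by auto
  have left: "(\<exists>c'>c. (r, c') \<in> ?Z) \<longleftrightarrow> (\<exists>c'>c. (r, c') \<in> Z) \<or> r \<in> S" if "c \<le> n" for r c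
    using that by (auto intro: exI[of _ "Suc n"])
  have no_left: "\<not> (\<exists>c'>Suc n. (r, c') \<in> ?Z)" for r
    using Zn by fastforce
  have col: "(\<forall>c\<in>col_labels (Suc n) R. \<exists>r. (r, c) \<in> ?Z) \<longleftrightarrow>
      (\<forall>c\<in>col_labels n R. \<exists>r. (r, c) \<in> Z) \<and> S \<noteq> {}"
    using Zn[of _ "Suc n"] Mn by (auto simp: col_labels_Suc_col[OF R])
  have sub: "?Z \<subseteq> cells (Suc n) R \<longleftrightarrow> S \<subseteq> R"
    using Z cell by (fastforce simp: cells_Suc_col[OF R])
  have Msub: "?M \<subseteq> col_labels (Suc n) R"
    using M assms(4) by (auto simp: col_labels_Suc_col[OF R])
  have diff: "cells (Suc n) R - ?Z = (cells n R - Z) \<union> (R - S) \<times> {Suc n}"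
    using cell Zn by (fastforce simp: cells_Suc_col[OF R])
  have restr: "(\<forall>(r, c)\<in>cells (Suc n) R - ?Z.
        (c \<in> ?M \<or> (\<exists>r'<r. (r', c) \<in> ?Z)) \<longrightarrow> \<not> (\<exists>c'>c. (r, c') \<in> ?Z)) \<longleftrightarrow>
      (\<forall>(r, c)\<in>cells n R - Z.
        (c \<in> M \<or> (\<exists>r'<r. (r', c) \<in> Z)) \<longrightarrow> \<not> ((\<exists>c'>c. (r, c') \<in> Z) \<or> r \<in> S))"
  proof -
    have "((c \<in> ?M \<or> (\<exists>r'<r. (r', c) \<in> ?Z)) \<longrightarrow> \<not> (\<exists>c'>c. (r, c') \<in> ?Z)) \<longleftrightarrow>
      ((c \<in> M \<or> (\<exists>r'<r. (r', c) \<in> Z)) \<longrightarrow> \<not> ((\<exists>c'>c. (r, c') \<in> Z) \<or> r \<in> S))"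
      if "(r, c) \<in> cells n R" for r c
      using above[of c r] left[of c r] cell[OF that] by presburger
    then show ?thesis
      unfolding diff using no_left by blast
  qed
  have "add_col n B S (R, Z, M) \<in> marked_tableaux (Suc n) \<longleftrightarrow>
      S \<subseteq> R \<and> (\<forall>c\<in>col_labels n R. \<exists>r. (r, c) \<in> Z) \<and> S \<noteq> {} \<and>
      (\<forall>(r, c)\<in>cells n R - Z.
        (c \<in> M \<or> (\<exists>r'<r. (r', c) \<in> Z)) \<longrightarrow> \<not> ((\<exists>c'>c. (r, c') \<in> Z) \<or> r \<in> S))"
    unfolding marked_tableaux_def add_col.simps mem_Collect_eq prod.case restr col sub
    using R Msub by auto
  also have "\<dots> \<longleftrightarrow> (R, Z, M) \<in> marked_tableaux n \<and> S \<in> Pow (active_rows n (R, Z, M)) - {{}}"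
  proof -
    \<comment> \<open>The disjunct \<open>r \<in> S\<close> forbids, in the rows of
      \<open>S\<close>, any \<open>0\<close> in a marked column or below a \<open>1\<close>: this is
      activity.\<close>
    have "S \<subseteq> R \<and> (\<forall>(r, c)\<in>cells n R - Z.
          (c \<in> M \<or> (\<exists>r'<r. (r', c) \<in> Z)) \<longrightarrow> \<not> ((\<exists>c'>c. (r, c') \<in> Z) \<or> r \<in> S)) \<longleftrightarrow>
        S \<subseteq> active_rows n (R, Z, M) \<and> (\<forall>(r, c)\<in>cells n R - Z.
          (c \<in> M \<or> (\<exists>r'<r. (r', c) \<in> Z)) \<longrightarrow> \<not> (\<exists>c'>c. (r, c') \<in> Z))"
      unfolding active_rows.simps by blast
    then show ?thesis
      unfolding marked_tableaux_def mem_Collect_eq prod.case using R Z M by blast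
  qed
  finally show ?thesis .
qed

text \<open>An old cell affects activity only through its own column, which is unchanged. The new
  \<open>0\<close>s lie in column \<open>Suc n\<close> at rows outside \<open>S\<close>; such a
  \<open>0\<close> deactivates its row if the column is marked or a row of \<open>S\<close> lies
  above.\<close>

lemma active_rows_add_col:
  assumes "T \<in> marked_tableaux n" "S \<subseteq> active_rows n T"
  shows "active_rows (Suc n) (add_col n {} S T) = {r\<in>active_rows n T. r \<in> S \<or> (\<forall>s\<in>S. r \<le> s)}"
    and "active_rows (Suc n) (add_col n {Suc n} S T) = S"
proof -
  obtain R Z M where T: "T = (R, Z, M)"
    by (cases T)
  have R: "R \<subseteq> {1..n}" and "Z \<subseteq> cells n R" and M: "M \<subseteq> col_labels n R"
    using assms(1) by (auto simp: T marked_tableaux_def)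
  then have cell: "c \<le> n" if "(r, c) \<in> cells n R \<or> (r, c) \<in> Z" for r c
    using that by (auto simp: cells_def col_labels_def)
  have Mn: "Suc n \<notin> M"
    using M by (auto simp: col_labels_def)
  have *: "r \<in> active_rows (Suc n) (add_col n B S T) \<longleftrightarrow>
      r \<in> active_rows n T \<and> (r \<in> S \<or> Suc n \<notin> B \<and> (\<forall>s\<in>S. r \<le> s))"
    if "B \<subseteq> {Suc n}" for B r
  proof -
    let ?Z = "Z \<union> S \<times> {Suc n}"
    have diff: "(r, c) \<in> cells (Suc n) R - ?Z \<longleftrightarrow> (r, c) \<in> cells n R - Z \<or> r \<in> R - S \<and> c = Suc n" for c
      using cell[of r "Suc n"] by (auto simp: cells_Suc_col[OF R])
    have old: "(c \<notin> M \<union> B \<and> \<not> (\<exists>r'<r. (r', c) \<in> ?Z)) \<longleftrightarrow> (c \<notin> M \<and> \<not> (\<exists>r'<r. (r', c) \<in> Z))"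
      if "(r, c) \<in> cells n R - Z" for c
      using cell[of r c] that \<open>B \<subseteq> {Suc n}\<close> by auto
    have new: "(Suc n \<notin> M \<union> B \<and> \<not> (\<exists>r'<r. (r', Suc n) \<in> ?Z)) \<longleftrightarrow> Suc n \<notin> B \<and> \<not> (\<exists>r'<r. r' \<in> S)"
      using cell[of _ "Suc n"] Mn by auto
    have "(\<forall>c. (r, c) \<in> cells (Suc n) R - ?Z \<longrightarrow> c \<notin> M \<union> B \<and> \<not> (\<exists>r'<r. (r', c) \<in> ?Z)) \<longleftrightarrow>
      (\<forall>c. (r, c) \<in> cells n R - Z \<longrightarrow> c \<notin> M \<and> \<not> (\<exists>r'<r. (r', c) \<in> Z)) \<and>
      (r \<in> R - S \<longrightarrow> Suc n \<notin> B \<and> \<not> (\<exists>r'<r. r' \<in> S))"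
      unfolding diff using old new by blast
    then have "r \<in> active_rows (Suc n) (add_col n B S T) \<longleftrightarrow>
      r \<in> active_rows n T \<and> (r \<in> R - S \<longrightarrow> Suc n \<notin> B \<and> \<not> (\<exists>r'<r. r' \<in> S))"
      unfolding T add_col.simps active_rows.simps mem_Collect_eq by blast
    moreover have "r \<in> R" if "r \<in> active_rows n T"
      using that by (simp add: T)
    ultimately show ?thesis
      by (meson Diff_iff not_less)
  qed
  show "active_rows (Suc n) (add_col n {} S T) = {r\<in>active_rows n T. r \<in> S \<or> (\<forall>s\<in>S. r \<le> s)}"
    using *[of "{}"] by blast
  show "active_rows (Suc n) (add_col n {Suc n} S T) = S"
    using *[of "{Suc n}"] assms(2) by blast
qed

section \<open>The generating polynomial by active rows and its recurrence\<close>

definition marked_gf :: "nat \<Rightarrow> nat \<Rightarrow> nat" where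
  "marked_gf n x = (\<Sum>T\<in>marked_tableaux n. x ^ card (active_rows n T))"

text \<open>Each tableau of length \<open>Suc n\<close> arises exactly once, by a new row, an
  unmarked column or a marked column. A tableau with \<open>a\<close> active rows contributes
  \<open>x^(a+1)\<close>, \<open>x (1+x)^a - x^(a+1)\<close> and \<open>(1+x)^a - 1\<close>
  respectively, together \<open>(1+x)^(a+1) - 1\<close>. Placing \<open>marked_gf n 1\<close>, the
  number of tableaux, on the left avoids subtraction of naturals.\<close>

lemma marked_gf_Suc: "marked_gf (Suc n) x + marked_gf n 1 = (1 + x) * marked_gf n (1 + x)"
proof -
  let ?T = "marked_tableaux n"
  let ?P = "SIGMA T:?T. Pow (active_rows n T) - {{}}"
  let ?f = "\<lambda>B (T, S). add_col n B S T"
  let ?w = "\<lambda>n T. x ^ card (active_rows n T)"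
  let ?a = "\<lambda>T. card (active_rows n T)"
  have fin: "finite ?T" "finite ?P"
    by (auto intro!: finite_SigmaI simp: finite_marked_tableaux finite_active_rows)
  have in_P: "\<exists>R Z M S. p = ((R, Z, M), S) \<and> R \<subseteq> {1..n} \<and> Z \<subseteq> cells n R \<and> M \<subseteq> col_labels n R \<and>
      (R, Z, M) \<in> ?T \<and> S \<in> Pow (active_rows n (R, Z, M)) - {{}}" if "p \<in> ?P" for p
    using that by (cases p) (auto simp: marked_tableaux_def)
  have dec: "marked_tableaux (Suc n) = add_row n ` ?T \<union> (?f {} ` ?P \<union> ?f {Suc n} ` ?P)"
  proof (intro equalityI subsetI)
    fix U assume U: "U \<in> marked_tableaux (Suc n)"
    obtain R Z M where U': "U = (R, Z, M)"
      by (cases U)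
    show "U \<in> add_row n ` ?T \<union> (?f {} ` ?P \<union> ?f {Suc n} ` ?P)"
    proof (cases "Suc n \<in> R")
      case True
      define R' where "R' = R - {Suc n}"
      have "R' \<subseteq> {1..n}" "R = insert (Suc n) R'"
        using U True by (auto simp: U' R'_def marked_tableaux_def)
      then have "U = add_row n (R', Z, M)" "(R', Z, M) \<in> ?T"
        using U add_row_marked_iff[of R' n Z M] by (auto simp: U')
      then show ?thesis by blast
    next
      case False
      \<comment> \<open>Undo the last column: remove its cells and its mark; its \<open>1\<close>s
        form \<open>S\<close>.\<close>
      define Z' M' S where "Z' = Z - UNIV \<times> {Suc n}" and "M' = M - {Suc n}" and "S = {r. (r, Suc n) \<in> Z}"
      have R: "R \<subseteq> {1..n}"
        using U False by (force simp: U' marked_tableaux_def le_Suc_eq)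
      have "Z \<subseteq> cells (Suc n) R" "M \<subseteq> col_labels (Suc n) R"
        using U by (auto simp: U' marked_tableaux_def)
      then have Z: "Z' \<subseteq> cells n R" and M: "M' \<subseteq> col_labels n R"
        by (auto simp: Z'_def M'_def cells_Suc_col[OF R] col_labels_Suc_col[OF R])
      \<comment> \<open>\<open>M \<inter> {Suc n}\<close> is \<open>{Suc n}\<close> or
        \<open>{}\<close> according to whether the last column is marked, so it serves as
        \<open>B\<close>.\<close>
      have eq: "U = add_col n (M \<inter> {Suc n}) S (R, Z', M')"
        by (auto simp: U' Z'_def M'_def S_def)
      then have P: "((R, Z', M'), S) \<in> ?P"
        using add_col_marked_iff[OF R Z M, of "M \<inter> {Suc n}" S] U by simp
      have "U = ?f (M \<inter> {Suc n}) ((R, Z', M'), S)"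
        by (simp only: eq prod.case)
      then have "U \<in> ?f (M \<inter> {Suc n}) ` ?P"
        using P by (rule image_eqI)
      moreover have "M \<inter> {Suc n} = {} \<or> M \<inter> {Suc n} = {Suc n}"
        by blast
      ultimately show ?thesis
        by (elim disjE) (simp_all only: Un_iff simp_thms)
    qed
  next
    fix U assume "U \<in> add_row n ` ?T \<union> (?f {} ` ?P \<union> ?f {Suc n} ` ?P)"
    then consider T where "T \<in> ?T" "U = add_row n T"
      | B p where "B = {} \<or> B = {Suc n}" "p \<in> ?P" "U = ?f B p"
      by blast
    then show "U \<in> marked_tableaux (Suc n)"
    proof cases
      case (1 T)
      moreover obtain R Z M where "T = (R, Z, M)"
        by (cases T)
      moreover from this 1 have "R \<subseteq> {1..n}"
        by (simp add: marked_tableaux_def)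
      ultimately show ?thesis
        using add_row_marked_iff[of R n Z M] by simp
    next
      case (2 B p)
      then have "B \<subseteq> {Suc n}" by blast
      with 2 in_P[OF 2(2)] show ?thesis
        using add_col_marked_iff[of _ n _ _ B] by fastforce
    qed
  qed
  have inj_row: "inj_on (add_row n) ?T"
    by (auto simp: inj_on_def marked_tableaux_def) (metis Suc_n_not_le_n atLeastAtMost_iff insertE subsetD insertI2)+
  have inj_col: "inj_on (?f B) ?P" if "B \<subseteq> {Suc n}" for B
  proof (rule inj_onI)
    fix p p' assume "p \<in> ?P" "p' \<in> ?P" and eq: "?f B p = ?f B p'"
    then obtain R Z M S R' Z' M' S' where p: "p = ((R, Z, M), S)" "p' = ((R', Z', M'), S')"
      and Z: "Z \<subseteq> cells n R" "Z' \<subseteq> cells n R'" and M: "M \<subseteq> col_labels n R" "M' \<subseteq> col_labels n R'"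
      using in_P[of p] in_P[of p'] by blast
    \<comment> \<open>Nothing old lies in column \<open>Suc n\<close>, so filtering by that column
      recovers \<open>Z\<close>, \<open>S\<close> and \<open>M\<close> from the result.\<close>
    have "(r, Suc n) \<notin> Z \<union> Z'" "Suc n \<notin> M \<union> M'" for r
      using Z M by (auto simp: cells_def col_labels_def)
    then have "{q \<in> Z \<union> S \<times> {Suc n}. snd q \<noteq> Suc n} = Z" "{q \<in> Z' \<union> S' \<times> {Suc n}. snd q \<noteq> Suc n} = Z'"
      "{r. (r, Suc n) \<in> Z \<union> S \<times> {Suc n}} = S" "{r. (r, Suc n) \<in> Z' \<union> S' \<times> {Suc n}} = S'"
      "(M \<union> B) - {Suc n} = M" "(M' \<union> B) - {Suc n} = M'"
      using that by fastforce+
    note retract = this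
    have "R = R'" "Z \<union> S \<times> {Suc n} = Z' \<union> S' \<times> {Suc n}" "M \<union> B = M' \<union> B"
      using eq unfolding p prod.case add_col.simps prod.inject by blast+
    note same = this
    have "Z = Z'"
      using arg_cong[OF same(2), of "\<lambda>X. {q \<in> X. snd q \<noteq> Suc n}"] by (simp only: retract)
    moreover have "S = S'"
      using arg_cong[OF same(2), of "\<lambda>X. {r. (r, Suc n) \<in> X}"] by (simp only: retract)
    moreover have "M = M'"
      using arg_cong[OF same(3), of "\<lambda>X. X - {Suc n}"] by (simp only: retract)
    ultimately show "p = p'"
      using same(1) by (simp only: p)
  qed
  \<comment> \<open>A new row shows as \<open>Suc n\<close> in the row set, a marked new column as
    \<open>Suc n\<close> among the marks.\<close>
  have disj: "add_row n ` ?T \<inter> (?f {} ` ?P \<union> ?f {Suc n} ` ?P) = {}" "?f {} ` ?P \<inter> ?f {Suc n} ` ?P = {}"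
    by (auto dest!: in_P simp: marked_tableaux_def col_labels_def)
  have row: "(\<Sum>T\<in>?T. ?w (Suc n) (add_row n T)) = (\<Sum>T\<in>?T. x * x ^ ?a T)"
  proof (intro sum.cong refl)
    fix T assume T: "T \<in> ?T"
    have "Suc n \<notin> active_rows n T"
      using T by (cases T) (auto simp: marked_tableaux_def)
    then show "?w (Suc n) (add_row n T) = x * x ^ ?a T"
      by (simp add: active_rows_add_row[OF T] finite_active_rows[OF T])
  qed
  have unmarked: "(\<Sum>p\<in>?P. ?w (Suc n) (?f {} p))
      = (\<Sum>T\<in>?T. \<Sum>S\<in>Pow (active_rows n T) - {{}}. x ^ card {r\<in>active_rows n T. r \<in> S \<or> (\<forall>s\<in>S. r \<le> s)})"
    by (subst sum.Sigma) (auto simp: finite_marked_tableaux finite_active_rows active_rows_add_col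
        simp del: active_rows.simps add_col.simps intro!: sum.cong)
  have marked: "(\<Sum>p\<in>?P. ?w (Suc n) (?f {Suc n} p)) = (\<Sum>T\<in>?T. \<Sum>S\<in>Pow (active_rows n T) - {{}}. x ^ card S)"
    by (subst sum.Sigma) (auto simp: finite_marked_tableaux finite_active_rows active_rows_add_col
        simp del: active_rows.simps add_col.simps intro!: sum.cong)
  have pow: "(\<Sum>S\<in>Pow (active_rows n T) - {{}}. x ^ card S) + 1 = (1 + x) ^ ?a T" if "T \<in> ?T" for T
    using sum.remove[of "Pow (active_rows n T)" "{}" "\<lambda>S. x ^ card S"] finite_active_rows[OF that]
    by (simp add: sum_Pow_power_card)
  have "marked_gf (Suc n) x = (\<Sum>T\<in>?T. ?w (Suc n) (add_row n T))
      + ((\<Sum>p\<in>?P. ?w (Suc n) (?f {} p)) + (\<Sum>p\<in>?P. ?w (Suc n) (?f {Suc n} p)))"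
    unfolding marked_gf_def dec using fin disj inj_row inj_col
    by (simp add: sum.union_disjoint sum.reindex)
  \<comment> \<open>Group by \<open>T\<close>: the new row completes the unmarked sum as in
    \<open>sum_Pow_power_card_initial\<close>, and the \<open>1\<close> that \<open>T\<close>
    contributes to \<open>marked_gf n 1\<close> is the missing term of the empty set in the marked
    sum.\<close>
  then have "marked_gf (Suc n) x + marked_gf n 1 = (\<Sum>T\<in>?T.
      ((\<Sum>S\<in>Pow (active_rows n T) - {{}}. x ^ card {r\<in>active_rows n T. r \<in> S \<or> (\<forall>s\<in>S. r \<le> s)})
        + x * x ^ ?a T) + ((\<Sum>S\<in>Pow (active_rows n T) - {{}}. x ^ card S) + 1))"
    unfolding row unmarked marked by (simp only: marked_gf_def power_one sum.distrib ac_simps)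
  also have "\<dots> = (\<Sum>T\<in>?T. x * (1 + x) ^ ?a T + (1 + x) ^ ?a T)"
    by (intro sum.cong refl) (simp only: sum_Pow_power_card_initial finite_active_rows pow)
  finally show ?thesis
    by (simp add: marked_gf_def sum.distrib sum_distrib_left)
qed

section \<open>Solving the recurrence\<close>

lemma marked_gf_0: "marked_gf 0 x = 1"
proof -
  have "marked_tableaux 0 = {({}, {}, {})}"
    by (auto simp: marked_tableaux_def cells_def col_labels_def)
  then show ?thesis
    by (simp add: marked_gf_def)
qed

text \<open>The recurrence shifts \<open>x\<close> to \<open>x + 1\<close>, hence the induction for
  all \<open>x\<close>. Multiplying the hypothesis at \<open>x + 1\<close> by \<open>x + 1\<close>
  lengthens each rising factorial by one factor at the front, and \<open>marked_gf_Suc\<close>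
  splits the leading term into \<open>marked_gf (Suc n) x\<close> and the new summand
  \<open>j = n\<close>.\<close>

lemma pochhammer_marked_gf:
  "pochhammer (x + 1) n = marked_gf n x + (\<Sum>j<n. marked_gf j 1 * pochhammer (x + 1) (n - 1 - j))"
proof (induction n arbitrary: x)
  case 0
  then show ?case by (simp add: marked_gf_0)
next
  case (Suc n)
  have *: "(x + 1) * pochhammer (x + 1 + 1) (n - 1 - j) = pochhammer (x + 1) (n - j)" if "j < n" for j
  proof -
    have "n - j = Suc (n - 1 - j)" using that by simp
    then show ?thesis by (simp only: pochhammer_rec)
  qed
  have "pochhammer (x + 1) (Suc n) = (x + 1) * pochhammer (x + 1 + 1) n"
    by (rule pochhammer_rec)
  also have "\<dots> = (1 + x) * marked_gf n (1 + x)
      + (\<Sum>j<n. marked_gf j 1 * ((x + 1) * pochhammer (x + 1 + 1) (n - 1 - j)))"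
    by (simp only: Suc.IH[of "x + 1"] sum_distrib_left distrib_left mult.left_commute add.commute[of 1 x])
  also have "(\<Sum>j<n. marked_gf j 1 * ((x + 1) * pochhammer (x + 1 + 1) (n - 1 - j)))
      = (\<Sum>j<n. marked_gf j 1 * pochhammer (x + 1) (n - j))"
    by (intro sum.cong refl) (simp only: * lessThan_iff)
  finally show ?case
    by (simp add: marked_gf_Suc[symmetric] del: One_nat_def)
qed

text \<open>At \<open>x = 0\<close> the rising factorials become factorials and the leading term
  vanishes, since the recurrence then has \<open>marked_gf n 1\<close> on both sides.\<close>

lemma fact_Suc_marked_gf: "fact (Suc n) = (\<Sum>j\<le>n. marked_gf j 1 * fact (n - j))"
proof -
  have "marked_gf (Suc n) 0 = 0"
    using marked_gf_Suc[of n 0] by simp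
  then show ?thesis
    using pochhammer_marked_gf[of 0 "Suc n"]
    by (simp add: lessThan_Suc_atMost pochhammer_fact del: One_nat_def)
qed

section \<open>Permutations split after their first connected component\<close>

text \<open>A permutation of \<open>A \<union> B\<close> that preserves \<open>A\<close> also
  preserves \<open>B\<close>. The inverse map takes its restrictions to \<open>A\<close> and to
  \<open>B\<close>, each extended by the identity.\<close>

lemma bij_betw_permutes_disjoint_Un:
  assumes "A \<inter> B = {}"
  shows "bij_betw (\<lambda>(q, s). q \<circ> s) ({q. q permutes A} \<times> {s. s permutes B})
    {p. p permutes A \<union> B \<and> p ` A = A}"
proof (rule bij_betw_byWitness)
  let ?f = "\<lambda>(q, s). q \<circ> s"
  let ?on = "\<lambda>A p x. if x \<in> A then p x else x"
  let ?g = "\<lambda>p. (?on A p, ?on B p)"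
  show "\<forall>a\<in>{q. q permutes A} \<times> {s. s permutes B}. ?g (?f a) = a"
  proof (clarify, intro conjI ext)
    fix q s x assume q: "q permutes A" and s: "s permutes B"
    then show "?on A (q \<circ> s) x = q x"
      using assms permutes_not_in[OF s, of x] permutes_not_in[OF q, of x] by (auto simp: disjoint_iff)
    have "q (s x) = s x" if "x \<in> B"
      using that assms permutes_in_image[OF s, of x] by (auto intro!: permutes_not_in[OF q])
    then show "?on B (q \<circ> s) x = s x"
      using permutes_not_in[OF s, of x] by auto
  qed
  show "\<forall>p\<in>{p. p permutes A \<union> B \<and> p ` A = A}. ?f (?g p) = p"
  proof (intro ballI ext)
    fix p x assume "p \<in> {p. p permutes A \<union> B \<and> p ` A = A}"
    then have p: "p permutes A \<union> B" "p ` A = A"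
      by blast+
    \<comment> \<open>In the composition the \<open>A\<close> part acts after the \<open>B\<close>
      part, so it must leave \<open>p x\<close> alone for \<open>x\<close> in
      \<open>B\<close>.\<close>
    have "p x \<notin> A" if "x \<notin> A"
      using that p permutes_inj[OF p(1)] by (metis imageE injD)
    then show "?f (?g p) x = p x"
      using assms permutes_not_in[OF p(1), of x] by auto
  qed
  show "?f ` ({q. q permutes A} \<times> {s. s permutes B}) \<subseteq> {p. p permutes A \<union> B \<and> p ` A = A}"
  proof (rule image_subsetI)
    fix a assume "a \<in> {q. q permutes A} \<times> {s. s permutes B}"
    then obtain q s where a: "a = (q, s)" and q: "q permutes A" and s: "s permutes B"
      by blast
    have "(q \<circ> s) permutes A \<union> B"
      by (rule permutes_compose) (use q s in \<open>auto intro: permutes_subset\<close>)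
    moreover have "s x = x" if "x \<in> A" for x
      using that assms by (auto intro!: permutes_not_in[OF s])
    then have "(q \<circ> s) ` A = A"
      by (simp add: image_comp[symmetric] permutes_image[OF q])
    ultimately show "?f a \<in> {p. p permutes A \<union> B \<and> p ` A = A}"
      by (simp add: a)
  qed
  show "?g ` {p. p permutes A \<union> B \<and> p ` A = A} \<subseteq> {q. q permutes A} \<times> {s. s permutes B}"
  proof (rule image_subsetI)
    fix p assume "p \<in> {p. p permutes A \<union> B \<and> p ` A = A}"
    then have p: "p permutes A \<union> B" "p ` A = A"
      by blast+
    have on: "?on C p permutes C" if "p ` C = C" for C
    proof (rule bij_imp_permutes)
      have "bij_betw p C C"
        using that permutes_inj[OF p(1)] by (auto simp: bij_betw_def intro: inj_on_subset)
      then show "bij_betw (?on C p) C C"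
        by (rule iffD1[OF bij_betw_cong, rotated]) simp
    qed simp
    have "B = (A \<union> B) - A"
      using assms by blast
    then have "p ` B = B"
      using image_set_diff[OF permutes_inj[OF p(1)], of "A \<union> B" A] permutes_image[OF p(1)] p(2) by metis
    then show "?g p \<in> {q. q permutes A} \<times> {s. s permutes B}"
      using on p(2) by blast
  qed
qed

text \<open>Prefix lengths are shifted to \<open>Suc k\<close> so that connectedness matches a
  search for the least stable index starting at 0.\<close>

lemma connected_perm_Suc:
  "connected_perm (Suc j) q \<longleftrightarrow> q permutes {1..Suc j} \<and> (\<forall>k<j. q ` {1..Suc k} \<noteq> {1..Suc k})"
proof -
  have "(\<exists>k. 1 \<le> k \<and> k < Suc j \<and> P k) \<longleftrightarrow> (\<exists>k<j. P (Suc k))" for P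
    by (metis One_nat_def Suc_le_D Suc_le_mono Suc_less_eq le0)
  then show ?thesis
    by (simp only: connected_perm_def) blast
qed

text \<open>Classify permutations by the least \<open>j\<close> whose prefix of length
  \<open>Suc j\<close> is mapped onto itself. Minimality makes the prefix part connected; the
  remaining \<open>n - j\<close> points are permuted freely.\<close>

lemma fact_Suc_num_connected_perms:
  "fact (Suc n) = (\<Sum>j\<le>n. num_connected_perms (Suc j) * fact (n - j))"
proof -
  let ?m = "Suc n"
  let ?stab = "\<lambda>p j. p ` {1..Suc j} = {1..Suc j}"
  let ?C = "\<lambda>j. {q. connected_perm (Suc j) q} \<times> {s. s permutes {Suc (Suc j)..?m}}"
  let ?D = "\<lambda>j. {p. p permutes {1..?m} \<and> ?stab p j \<and> (\<forall>k<j. \<not> ?stab p k)}"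
  have "{p. p permutes {1..?m}} = (\<Union>j\<le>n. ?D j)"
  proof (intro equalityI subsetI)
    fix p assume "p \<in> {p. p permutes {1..?m}}"
    then have p: "p permutes {1..?m}" by simp
    \<comment> \<open>The full prefix is stable, so a least stable index exists and is at most
      \<open>n\<close>.\<close>
    then have "?stab p n"
      by (rule permutes_image)
    then obtain j where "?stab p j" "\<forall>k<j. \<not> ?stab p k"
      using exists_least_iff[of "?stab p"] by blast
    moreover from this \<open>?stab p n\<close> have "j \<le> n"
      by (meson not_less)
    ultimately show "p \<in> (\<Union>j\<le>n. ?D j)"
      using p by blast
  qed blast
  then have "fact ?m = card (\<Union>j\<le>n. ?D j)"
    using card_permutations[of "{1..?m}" ?m] by simp
  also have "\<dots> = (\<Sum>j\<le>n. card (?D j))"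
  proof (rule card_UN_disjoint)
    show "\<forall>j\<in>{..n}. finite (?D j)"
      by (rule ballI, rule finite_subset[of _ "{p. p permutes {1..?m}}"]) (auto simp: finite_permutations)
    show "\<forall>i\<in>{..n}. \<forall>j\<in>{..n}. i \<noteq> j \<longrightarrow> ?D i \<inter> ?D j = {}"
    proof (intro ballI impI)
      fix i j :: nat assume "i \<noteq> j"
      then have "i < j \<or> j < i" by linarith
      then show "?D i \<inter> ?D j = {}" by (elim disjE) blast+
    qed
  qed simp
  also have "\<dots> = (\<Sum>j\<le>n. num_connected_perms (Suc j) * fact (n - j))"
  proof (rule sum.cong)
    fix j assume "j \<in> {..n}"
    then have j: "j \<le> n" by simp
    let ?A = "{1..Suc j}" and ?B = "{Suc (Suc j)..?m}"
    have Un: "?A \<union> ?B = {1..?m}" and disj: "?A \<inter> ?B = {}"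
      using j by auto
    note bij = bij_betw_permutes_disjoint_Un[OF disj, unfolded Un]
    \<comment> \<open>\<open>s\<close> moves only points above \<open>Suc j\<close>, so it fixes
      every prefix tested and stability depends on \<open>q\<close> alone.\<close>
    have "?stab (q \<circ> s) k \<longleftrightarrow> ?stab q k" if "s permutes ?B" "k \<le> j" for q s k
    proof -
      have "s i = i" if "i \<in> {1..Suc k}" for i
        using \<open>k \<le> j\<close> that by (auto intro!: permutes_not_in[OF \<open>s permutes ?B\<close>])
      then show ?thesis
        by (simp add: image_comp[symmetric])
    qed
    then have D_iff: "q \<circ> s \<in> ?D j \<longleftrightarrow> (q, s) \<in> ?C j" if "q permutes ?A" "s permutes ?B" for q s
      using that bij_betwE[OF bij] by (auto simp: connected_perm_Suc simp del: One_nat_def)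
    have image: "(\<lambda>(q, s). q \<circ> s) ` ?C j = ?D j"
    proof (intro equalityI subsetI)
      fix p assume "p \<in> ?D j"
      then have "p \<in> {p. p permutes {1..?m} \<and> p ` ?A = ?A}"
        by (simp only: mem_Collect_eq)
      then have "p \<in> (\<lambda>(q, s). q \<circ> s) ` ({q. q permutes ?A} \<times> {s. s permutes ?B})"
        unfolding bij_betw_imp_surj_on[OF bij] .
      then obtain q s where qs: "q permutes ?A" "s permutes ?B" and p: "p = (\<lambda>(q, s). q \<circ> s) (q, s)"
        by (elim imageE SigmaE) (simp only: mem_Collect_eq)
      have "(q, s) \<in> ?C j"
        using \<open>p \<in> ?D j\<close> unfolding p prod.case D_iff[OF qs] .
      with p show "p \<in> (\<lambda>(q, s). q \<circ> s) ` ?C j"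
        by (rule image_eqI)
    next
      fix p assume "p \<in> (\<lambda>(q, s). q \<circ> s) ` ?C j"
      then obtain q s where C: "(q, s) \<in> ?C j" and p: "p = q \<circ> s"
        by (elim imageE) (simp only: split_paired_all prod.case)
      then have "q permutes ?A" "s permutes ?B"
        by (simp_all only: connected_perm_def mem_Times_iff mem_Collect_eq fst_conv snd_conv)
      from D_iff[OF this] C show "p \<in> ?D j"
        unfolding p by (rule iffD2)
    qed
    have inj: "inj_on (\<lambda>(q, s). q \<circ> s) (?C j)"
      by (rule inj_on_subset[OF bij_betw_imp_inj_on[OF bij]]) (auto simp: connected_perm_def)
    have "card (?D j) = card (?C j)"
      using card_image[OF inj] unfolding image .
    \<comment> \<open>\<open>?B\<close> has \<open>n - j\<close> elements; for \<open>j = n\<close>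
      it is empty and gives the factor 0! = 1.\<close>
    then show "card (?D j) = num_connected_perms (Suc j) * fact (n - j)"
      using j by (simp add: card_cartesian_product num_connected_perms_def card_permutations)
  qed simp
  finally show ?thesis .
qed

section \<open>Comparison of the two sequences, and the return to permutation tableaux\<close>

text \<open>Both sequences satisfy the same recurrence for \<open>fact (Suc n)\<close>. Its term
  \<open>j = n\<close> has coefficient 0! = 1, so earlier values determine the next one.\<close>

lemma marked_gf_eq_num_connected_perms: "marked_gf n 1 = num_connected_perms (Suc n)"
proof (induction n rule: less_induct)
  case (less n)
  have "(\<Sum>j<n. marked_gf j 1 * fact (n - j)) = (\<Sum>j<n. num_connected_perms (Suc j) * fact (n - j))"
    using less by simp
  moreover have "(\<Sum>j\<le>n. marked_gf j 1 * fact (n - j))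
     = (\<Sum>j\<le>n. num_connected_perms (Suc j) * fact (n - j))"
    using fact_Suc_marked_gf[of n] fact_Suc_num_connected_perms[of n] by metis
  ultimately show ?case
    by (simp del: One_nat_def flip: lessThan_Suc_atMost)
qed

text \<open>\<open>2 ^ urc n T\<close> counts the sets of unrestricted columns of \<open>T\<close>,
  so the sum counts tableaux with such a set marked. Replacing the filling by its set of
  \<open>1\<close>s gives the triples of \<open>marked_tableaux n\<close>.\<close>

lemma sum_urc: "(\<Sum>T\<in>permutation_tableaux n. 2 ^ urc n T) = marked_gf n 1"
proof -
  let ?U = "\<lambda>T. {c. unrestricted_col n (fst T) (snd T) c}"
  let ?P = "SIGMA T:permutation_tableaux n. Pow (?U T)"
  let ?ones = "\<lambda>R F. {q\<in>cells n R. F q = 1}"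
  \<comment> \<open>Restricting to the cells leaves the filling undefined elsewhere, as extensional
    fillings require.\<close>
  let ?fill = "\<lambda>R Z. \<lambda>q\<in>cells n R. if q \<in> Z then 1 else (0::nat)"
  have finU: "finite (?U T)" for T
    by (rule finite_subset[of _ "{1..n}"]) (auto simp: unrestricted_col_def col_labels_def)
  have iff: "((R, F), M) \<in> ?P \<longleftrightarrow> (R, ?ones R F, M) \<in> marked_tableaux n"
    if F: "F \<in> cells n R \<rightarrow>\<^sub>E {0, 1}" for R F M
  proof -
    let ?Z = "?ones R F"
    have above: "one_above n R F r c \<longleftrightarrow> (\<exists>r'<r. (r', c) \<in> ?Z)" for r c
      by (auto simp: one_above_def)
    have left: "one_left n R F r c \<longleftrightarrow> (\<exists>c'>c. (r, c') \<in> ?Z)" for r c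
      by (auto simp: one_left_def)
    \<comment> \<open>Entries are 0 or 1, so a cell holds 0 exactly when it is outside
      \<open>?Z\<close>.\<close>
    have zero: "q \<in> cells n R \<and> F q = 0 \<longleftrightarrow> q \<in> cells n R - ?Z" for q
      using F by (auto dest: PiE_mem)
    have "((R, F), M) \<in> ?P \<longleftrightarrow> R \<subseteq> {1..n} \<and> (\<forall>c\<in>col_labels n R. \<exists>r. (r, c) \<in> ?Z) \<and>
        (\<forall>r c. (r, c) \<in> cells n R \<and> F (r, c) = 0 \<longrightarrow> \<not> (one_above n R F r c \<and> one_left n R F r c)) \<and>
        (\<forall>c\<in>M. c \<in> col_labels n R \<and>
          (\<forall>r. (r, c) \<in> cells n R \<and> F (r, c) = 0 \<longrightarrow> \<not> one_left n R F r c))"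
      using F by (auto simp: permutation_tableaux_def unrestricted_col_def subset_iff simp del: neq0_conv)
    \<comment> \<open>A \<open>0\<close> with a \<open>1\<close> to its left may neither have a
      \<open>1\<close> above it nor lie in a marked column: the two requirements merge into the last
      condition of \<open>marked_tableaux\<close>.\<close>
    also have "\<dots> \<longleftrightarrow> (R, ?Z, M) \<in> marked_tableaux n"
      unfolding zero above left marked_tableaux_def mem_Collect_eq[of _ "\<lambda>(R, Z, M). _ R Z M"] prod.case
      by blast
    finally show ?thesis .
  qed
  have "bij_betw (\<lambda>((R, F), M). (R, ?ones R F, M)) ?P (marked_tableaux n)"
  proof (rule bij_betw_byWitness[where f' = "\<lambda>(R, Z, M). ((R, ?fill R Z), M)"])
    show "\<forall>a\<in>?P. (\<lambda>(R, Z, M). ((R, ?fill R Z), M)) ((\<lambda>((R, F), M). (R, ?ones R F, M)) a) = a"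
    proof
      fix a assume "a \<in> ?P"
      moreover obtain R F M where a: "a = ((R, F), M)"
        by (metis prod.exhaust)
      ultimately have F: "F \<in> cells n R \<rightarrow>\<^sub>E {0, 1}"
        by (auto simp: permutation_tableaux_def)
      have "?fill R (?ones R F) = F"
      proof (rule extensionalityI)
        show "F \<in> extensional (cells n R)"
          using F by (simp add: PiE_def)
        show "?fill R (?ones R F) q = F q" if "q \<in> cells n R" for q
          using PiE_mem[OF F that] that by auto
      qed simp
      then show "(\<lambda>(R, Z, M). ((R, ?fill R Z), M)) ((\<lambda>((R, F), M). (R, ?ones R F, M)) a) = a"
        by (simp only: a prod.case)
    qed
    show "\<forall>a\<in>marked_tableaux n. (\<lambda>((R, F), M). (R, ?ones R F, M)) ((\<lambda>(R, Z, M). ((R, ?fill R Z), M)) a) = a"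
      by (auto simp: marked_tableaux_def)
    show "(\<lambda>((R, F), M). (R, ?ones R F, M)) ` ?P \<subseteq> marked_tableaux n"
    proof (rule image_subsetI)
      fix a assume "a \<in> ?P"
      moreover obtain R F M where a: "a = ((R, F), M)"
        by (metis prod.exhaust)
      ultimately have "F \<in> cells n R \<rightarrow>\<^sub>E {0, 1}" and "((R, F), M) \<in> ?P"
        by (auto simp: permutation_tableaux_def)
      then show "(\<lambda>((R, F), M). (R, ?ones R F, M)) a \<in> marked_tableaux n"
        unfolding a prod.case using iff by blast
    qed
    show "(\<lambda>(R, Z, M). ((R, ?fill R Z), M)) ` marked_tableaux n \<subseteq> ?P"
    proof (rule image_subsetI)
      fix a assume "a \<in> marked_tableaux n"
      moreover obtain R Z M where a: "a = (R, Z, M)"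
        by (metis prod.exhaust)
      ultimately have *: "(R, Z, M) \<in> marked_tableaux n" "Z \<subseteq> cells n R"
        by (auto simp: marked_tableaux_def)
      have fill: "?fill R Z \<in> cells n R \<rightarrow>\<^sub>E {0, 1}"
        by auto
      have "?ones R (?fill R Z) = Z"
        using *(2) by auto
      then show "(\<lambda>(R, Z, M). ((R, ?fill R Z), M)) a \<in> ?P"
        unfolding a prod.case iff[OF fill] using *(1) by (simp only:)
    qed
  qed
  then have "card ?P = card (marked_tableaux n)"
    by (rule bij_betw_same_card)
  moreover have "card ?P = (\<Sum>T\<in>permutation_tableaux n. 2 ^ urc n T)"
    using finU by (simp add: card_SigmaI finite_permutation_tableaux card_Pow urc_def)
  ultimately show ?thesis
    by (simp add: marked_gf_def)
qed

theorem corollary1p2: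
  fixes n :: nat
  shows "(\<Sum>T\<in>permutation_tableaux n. 2 ^ urc n T) = num_connected_perms (n + 1)"
  by (simp only: sum_urc marked_gf_eq_num_connected_perms Suc_eq_plus1)

end
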